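(* Let $\mathcal{X}$ be a finite set, $P_X$ a probability distribution on $\mathcal{X}$, $\rho>0$, and for each $n$ let $\mathbf{X}_n=(X_1,\dots,X_n)$ be i.i.d. with law $P_X$. Let $\mathcal{A}$ be a nonempty countable (possibly infinite) set of agents. A strategy consists of, for each agent $a\in\mathcal{A}$, a (possibly random) sequence of guesses $\{\hat{\mathbf{X}}^{(a)}_k: k\ge 1\}$ with values in $\mathcal{X}^n$, independent of $\mathbf{X}_n$ (but allowed to depend on $P_X$), the sequences being independent over $a\in\mathcal{A}$. Let $\Pi$ be the set of all bijections $\pi:\mathbb{N}^+\to\mathcal{A}\times\mathbb{N}^+$; for $\pi\in\Pi$ with $\pi(i)=(a_i,k_i)$, write $\pi(\hat{\mathbf{X}}_1^\infty)$ for the sequence $\{\hat{\mathbf{X}}^{(a_i)}_{k_i}: i\ge1\}$ and $$G(\mathbf{X}_n,\pi(\hat{\mathbf{X}}_1^\infty))=\inf\{i\ge1:\hat{\mathbf{X}}^{(a_i)}_{k_i}=\mathbf{X}_n\}.$$ Let $G^*(\mathbf{X}_n)$ denote the position of $\mathbf{X}_n$ in a list of all elements of $\mathcal{X}^n$ sorted in decreasing order of their probability under the product distribution $P_X^{\otimes n}$ (ties broken arbitrarily). Then $$\lim_{n\to\infty}\frac1n\log\Big(\inf_{\text{strategies}}\ \sup_{\pi\in\Pi}\ \mathbb{E}\big[G(\mathbf{X}_n,\pi(\hat{\mathbf{X}}_1^\infty))^\rho\big]\Big)=\lim_{n\to\infty}\frac1n\log\mathbb{E}\big[G^*(\mathbf{X}_n)^\rho\big]=\rho\,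 H_{\frac{1}{1+\rho}}(X),$$ where $X\sim P_X$.
   Context: Logarithms are natural. For $\alpha>0$, $\alpha\neq1$, the Rényi entropy of order $\alpha$ of $X\sim P_X$ is $H_\alpha(X)=\frac{1}{1-\alpha}\log\sum_{x\in\mathcal{X}}P_X(x)^\alpha$. The expectation is over $\mathbf{X}_n$ and the randomness of the guesses. The infimum is over all strategies as described. *)

theory Defs
  imports "HOL-Probability.Probability"
begin

definition renyi_entropy :: "real \<Rightarrow> 'x::finite pmf \<Rightarrow> real" where
  "renyi_entropy \<alpha> p = 1 / (1 - \<alpha>) * ln (\<Sum>x\<in>UNIV. pmf p x powr \<alpha>)"

definition seqs :: "nat \<Rightarrow> 'x list set" where
  "seqs n = {xs. length xs = n}"

definition prod_prob :: "'x pmf \<Rightarrow> 'x list \<Rightarrow> real" where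
  "prod_prob p xs = (\<Prod>i<length xs. pmf p (xs ! i))"

text \<open>Guessing positions are 0-based internally, so the guess at index i has position Suc i.
  The value is G^rho, with G = infinity if the target is never guessed.
  Here w a k is the k-th guess of agent a and pi i = (a_i, k_i).\<close>
definition guess_pow :: "real \<Rightarrow> (nat \<Rightarrow> 'a \<times> nat) \<Rightarrow> ('a \<Rightarrow> nat \<Rightarrow> 'y) \<Rightarrow> 'y \<Rightarrow> ennreal" where
  "guess_pow \<rho> \<pi> w x =
     (if \<exists>i. w (fst (\<pi> i)) (snd (\<pi> i)) = x
      then ennreal (real (Suc (LEAST i. w (fst (\<pi> i)) (snd (\<pi> i)) = x)) powr \<rho>)
      else \<infinity>)"

text \<open>A strategy for block length n: for each agent a law of its guess sequence
  (a probability measure on sequences in X^n); agents are independent (product measure).\<close>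
definition strategies :: "'a set \<Rightarrow> nat \<Rightarrow> ('a \<Rightarrow> (nat \<Rightarrow> 'x list) measure) set" where
  "strategies A n = {\<mu>. \<forall>a\<in>A. prob_space (\<mu> a) \<and>
       sets (\<mu> a) = sets (PiM (UNIV :: nat set) (\<lambda>_. count_space (seqs n)))}"

text \<open>E[G(X_n, pi(guesses))^rho], X_n i.i.d. p independent of the guesses.\<close>
definition strategy_cost :: "'a set \<Rightarrow> 'x pmf \<Rightarrow> real \<Rightarrow> nat \<Rightarrow> ('a \<Rightarrow> (nat \<Rightarrow> 'x list) measure)
     \<Rightarrow> (nat \<Rightarrow> 'a \<times> nat) \<Rightarrow> ennreal" where
  "strategy_cost A p \<rho> n \<mu> \<pi> =
     (\<Sum>xs\<in>seqs n. ennreal (prod_prob p xs) * (\<integral>\<^sup>+ w. guess_pow \<rho> \<pi> w xs \<partial>(PiM A \<mu>)))"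

definition opt_value :: "'a set \<Rightarrow> 'x pmf \<Rightarrow> real \<Rightarrow> nat \<Rightarrow> ennreal" where
  "opt_value A p \<rho> n =
     (INF \<mu>\<in>strategies A n. SUP \<pi>\<in>{\<pi>. bij_betw \<pi> UNIV (A \<times> UNIV)}. strategy_cost A p \<rho> n \<mu> \<pi>)"

definition optimal_ranking :: "'x pmf \<Rightarrow> nat \<Rightarrow> ('x list \<Rightarrow> nat) \<Rightarrow> bool" where
  "optimal_ranking p n g \<longleftrightarrow>
     bij_betw g (seqs n) {1..card (seqs n :: 'x list set)} \<and>
     (\<forall>xs\<in>seqs n. \<forall>ys\<in>seqs n. g xs < g ys \<longrightarrow> prod_prob p ys \<le> prod_prob p xs)"

definition opt_ranking_cost :: "'x pmf \<Rightarrow> real \<Rightarrow> nat \<Rightarrow> ('x list \<Rightarrow> nat) \<Rightarrow> real" where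
  "opt_ranking_cost p \<rho> n g = (\<Sum>xs\<in>seqs n. prod_prob p xs * real (g xs) powr \<rho>)"

end

(* With a = 1 / (1 + rho) and S the sum of p x powr a, every quantity lies between
   S powr (n * (1 + rho)) / (2 + n * ln CARD('x)) powr rho and a constant multiple of
   S powr (n * (1 + rho)), so the logarithmic growth rate is (1 + rho) * ln S.
   Lower bound (Arikan): for a fixed realisation of the guesses the guessing numbers of distinct
   sequences are distinct, so the sum of their reciprocals is at most harmonic, and a reverse
   Hoelder inequality bounds the moment for any such numbering.
   Upper bound: all agents draw i.i.d. guesses from the tilted law Q proportional to P powr a.
   For every interleaving the number of guesses is then geometric with parameter Q x, and its
   moment of order rho is O((1 / Q x) powr rho), with a constant that does not depend on n. *)
theory Submission
  imports Defs "HOL-Real_Asymp.Real_Asymp"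
begin

section \<open>Reciprocal sums and the moment bound for injective numberings\<close>

lemma harm_le_one_plus_ln:
  assumes "n \<ge> 1"
  shows "harm n \<le> 1 + ln (real n)"
proof -
  obtain m where m: "n = Suc m" using assms by (cases n) auto
  have "harm (Suc m) - ln (real (Suc m)) \<le> harm (Suc 0) - ln (real (Suc 0))"
    using decseqD[OF decseq_harm_diff_ln, of 0 m] by simp
  then show ?thesis by (simp add: m harm_expand)
qed

text \<open>The values of \<open>G\<close> may exceed \<open>N\<close>. Those in
  \<open>{1..N}\<close> are distinct and contribute at most \<open>harm N\<close>; each larger one
  contributes at most \<open>1 / N\<close>, and there are at most \<open>N\<close> of them, which
  adds at most \<open>1\<close>.\<close>

lemma sum_reciprocal_le:
  fixes G :: "'b \<Rightarrow> nat"
  assumes "finite T" "inj_on G T" "\<And>x. x \<in> T \<Longrightarrow> G x \<ge> 1" "card T \<le> N" "N \<ge> 1"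
  shows "(\<Sum>x\<in>T. 1 / real (G x)) \<le> 2 + ln (real N)"
proof -
  have "(\<Sum>x\<in>T. 1 / real (G x)) = (\<Sum>b\<in>G ` T. 1 / real b)"
    using assms(2) by (simp add: sum.reindex)
  also have "\<dots> \<le> (\<Sum>b\<in>G ` T. (if b \<in> {1..N} then 1 / real b else 0) + 1 / real N)"
    using assms by (intro sum_mono) (auto intro!: divide_left_mono simp: Suc_le_eq)
  also have "\<dots> = (\<Sum>b\<in>G ` T \<inter> {1..N}. 1 / real b) + real (card (G ` T)) / real N"
    using assms(1) by (simp add: sum.distrib sum.inter_restrict)
  also have "\<dots> \<le> harm N + 1"
  proof (rule add_mono)
    show "(\<Sum>b\<in>G ` T \<inter> {1..N}. 1 / real b) \<le> harm N"
      unfolding harm_def by (simp add: divide_inverse, rule sum_mono2) auto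
    show "real (card (G ` T)) / real N \<le> 1"
      using assms by (simp add: card_image)
  qed
  also have "\<dots> \<le> 2 + ln (real N)"
    using harm_le_one_plus_ln[OF assms(5)] by simp
  finally show ?thesis .
qed

text \<open>Combines \<open>1 - 1 / y \<le> ln y\<close> with \<open>1 + t \<le> exp t\<close>. The
  left side touches \<open>y powr \<rho>\<close> at \<open>y = 1\<close> and is affine in
  \<open>1 / y\<close>, so averaging it brings in the reciprocals of the guessing numbers.\<close>

lemma powr_tangent:
  assumes "y > (0::real)" "\<rho> > 0"
  shows "1 + \<rho> * (1 - 1 / y) \<le> y powr \<rho>"
proof -
  have "1 - 1 / y \<le> ln y"
    using ln_le_minus_one[of "1 / y"] assms by (simp add: ln_div)
  then have "1 + \<rho> * (1 - 1 / y) \<le> 1 + \<rho> * ln y" using assms by simp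
  also have "\<dots> \<le> exp (\<rho> * ln y)" by (rule exp_ge_add_one_self)
  finally show ?thesis using assms by (simp add: powr_def)
qed

text \<open>Reverse Hoelder inequality: sum the tangent inequality at \<open>y = Q x * G x * H\<close> against the
  tilted distribution \<open>Q\<close> proportional to \<open>P\<close> to the power \<open>1 / (1 + \<rho>)\<close>.\<close>

lemma guessing_moment_ge:
  fixes P :: "'b \<Rightarrow> real" and G :: "'b \<Rightarrow> nat"
  assumes T: "finite T" "T \<noteq> {}" and P: "\<And>x. x \<in> T \<Longrightarrow> P x > 0" and \<rho>: "\<rho> > 0"
    and G: "inj_on G T" "\<And>x. x \<in> T \<Longrightarrow> G x \<ge> 1" and N: "card T \<le> N"
  shows "(\<Sum>x\<in>T. P x powr (1 / (1 + \<rho>))) powr (1 + \<rho>) / (2 + ln (real N)) powr \<rho>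
    \<le> (\<Sum>x\<in>T. P x * real (G x) powr \<rho>)"
proof -
  define S where "S = (\<Sum>x\<in>T. P x powr (1 / (1 + \<rho>)))"
  define H where "H = 2 + ln (real N)"
  define Q where "Q x = P x powr (1 / (1 + \<rho>)) / S" for x
  have N1: "N \<ge> 1" using N T card_gt_0_iff[of T] by linarith
  have H: "H > 0" using N1 by (auto simp: H_def intro: add_pos_nonneg)
  have S: "S > 0" unfolding S_def using T P by (intro sum_pos) (auto dest: P)
  have Q: "Q x > 0" if "x \<in> T" for x using P[OF that] S by (auto simp: Q_def)
  have Qsum: "(\<Sum>x\<in>T. Q x) = 1"
    using S by (simp add: Q_def S_def flip: sum_divide_distrib)
  have PQ: "P x = S powr (1 + \<rho>) * (Q x * Q x powr \<rho>)" if "x \<in> T" for x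
  proof -
    have "Q x * Q x powr \<rho> = Q x powr (1 + \<rho>)" using Q[OF that] by (simp add: powr_add)
    also have "\<dots> = P x / S powr (1 + \<rho>)"
      using P[OF that] S \<rho> by (simp add: Q_def powr_divide powr_powr)
    finally show ?thesis using S by simp
  qed
  \<comment> \<open>\<open>H\<close> is the bound of \<open>sum_reciprocal_le\<close>. Under
    \<open>Q\<close> the average of \<open>1 / (Q x * G x * H)\<close> is the reciprocal sum divided
    by \<open>H\<close>, because the weight cancels, and so it is at most \<open>1\<close>.\<close>
  have "1 \<le> 1 + \<rho> * (1 - (\<Sum>x\<in>T. 1 / real (G x)) / H)"
    using sum_reciprocal_le[OF T(1) G N N1] H \<rho> by (simp add: H_def)
  also have "\<dots> = (1 + \<rho>) * (\<Sum>x\<in>T. Q x) - \<rho> * ((\<Sum>x\<in>T. 1 / real (G x)) / H)"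
    by (simp add: Qsum algebra_simps)
  also have "\<dots> = (\<Sum>x\<in>T. Q x * (1 + \<rho> * (1 - 1 / (Q x * real (G x) * H))))"
    unfolding sum_distrib_left sum_divide_distrib sum_subtractf[symmetric]
  proof (intro sum.cong refl)
    fix x assume "x \<in> T"
    then have "Q x \<noteq> 0" "real (G x) \<noteq> 0" "H \<noteq> 0" using Q[of x] G(2)[of x] H by auto
    then show "(1 + \<rho>) * Q x - \<rho> * (1 / real (G x) / H)
      = Q x * (1 + \<rho> * (1 - 1 / (Q x * real (G x) * H)))"
      by (simp add: field_simps)
  qed
  also have "\<dots> \<le> (\<Sum>x\<in>T. Q x * (Q x * real (G x) * H) powr \<rho>)"
  proof (intro sum_mono mult_left_mono powr_tangent)
    fix x assume "x \<in> T"
    then show "0 < Q x * real (G x) * H" "0 \<le> Q x" using Q[of x] G(2)[of x] H by auto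
  qed (use \<rho> in auto)
  \<comment> \<open>By \<open>PQ\<close>, \<open>Q x powr (1 + \<rho>)\<close> equals
    \<open>P x / S powr (1 + \<rho>)\<close>, which turns the tilted average into the moment under
    \<open>P\<close>.\<close>
  also have "\<dots> = (\<Sum>x\<in>T. P x * real (G x) powr \<rho>) * (H powr \<rho> / S powr (1 + \<rho>))"
    unfolding sum_distrib_right
  proof (intro sum.cong refl)
    fix x assume x: "x \<in> T"
    show "Q x * (Q x * real (G x) * H) powr \<rho>
      = P x * real (G x) powr \<rho> * (H powr \<rho> / S powr (1 + \<rho>))"
      using PQ[OF x] Q[OF x] H S by (simp add: powr_mult less_imp_le)
  qed
  finally show ?thesis using H S by (simp add: field_simps flip: S_def H_def)
qed

section \<open>Sequences of length n, product probabilities and their power sums\<close>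

lemma finite_seqs [simp]: "finite (seqs n :: 'x::finite list set)"
  using finite_lists_length_eq[of "UNIV :: 'x set" n] by (simp add: seqs_def)

lemma card_seqs: "card (seqs n :: 'x::finite list set) = CARD('x) ^ n"
  using card_lists_length_eq[of "UNIV :: 'x set" n] by (simp add: seqs_def)

lemma seqs_0: "seqs 0 = {[]}"
  by (auto simp: seqs_def)

lemma seqs_Suc: "seqs (Suc n) = (\<lambda>(x, xs). x # xs) ` (UNIV \<times> seqs n)"
  by (auto simp: seqs_def length_Suc_conv image_iff)

lemma prod_prob_Cons: "prod_prob p (x # xs) = pmf p x * prod_prob p xs"
  by (simp add: prod_prob_def prod.lessThan_Suc_shift del: prod.lessThan_Suc)

lemma prod_prob_nonneg [simp]: "prod_prob p xs \<ge> 0"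
  by (simp add: prod_prob_def prod_nonneg)

lemma sum_prod_prob_powr:
  fixes p :: "'x::finite pmf"
  shows "(\<Sum>xs\<in>seqs n. prod_prob p xs powr a) = (\<Sum>x\<in>UNIV. pmf p x powr a) ^ n"
proof (induction n)
  case 0
  then show ?case by (simp add: seqs_0 prod_prob_def)
next
  case (Suc n)
  have inj: "inj_on (\<lambda>(x, xs). x # xs) (UNIV \<times> seqs n :: ('x \<times> 'x list) set)"
    by (auto simp: inj_on_def)
  have "(\<Sum>xs\<in>seqs (Suc n). prod_prob p xs powr a)
      = (\<Sum>(x, xs)\<in>UNIV \<times> seqs n. pmf p x powr a * prod_prob p xs powr a)"
    unfolding seqs_Suc by (subst sum.reindex[OF inj]) (simp add: prod_prob_Cons powr_mult case_prod_unfold)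
  also have "\<dots> = (\<Sum>x\<in>UNIV. pmf p x powr a) * (\<Sum>xs\<in>seqs n. prod_prob p xs powr a)"
    by (simp add: sum_product sum.cartesian_product)
  finally show ?case by (simp add: Suc)
qed

lemma sum_pmf_powr_pos:
  fixes p :: "'x::finite pmf"
  shows "(\<Sum>x\<in>UNIV. pmf p x powr a) > 0"
proof -
  obtain x where "x \<in> set_pmf p" using set_pmf_not_empty by fast
  then show ?thesis by (intro sum_pos2[of _ x]) (auto simp: set_pmf_iff)
qed

text \<open>Since \<open>0 powr a = 0\<close>, null sequences drop out. The restriction matters
  because the moment bound needs positive weights and because null sequences may never be
  guessed.\<close>

lemma sum_prod_prob_powr_support:
  fixes p :: "'x::finite pmf"
  shows "(\<Sum>xs\<in>{xs\<in>seqs n. prod_prob p xs > 0}. prod_prob p xs powr a)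
    = (\<Sum>x\<in>UNIV. pmf p x powr a) ^ n"
  unfolding sum_prod_prob_powr[symmetric]
  by (rule sum.mono_neutral_left) (simp_all add: less_le)

lemma power_powr_swap:
  assumes "S > (0::real)"
  shows "(S ^ n) powr b = (S powr b) ^ n"
proof -
  have "(S ^ n) powr b = S powr (real n * b)"
    using assms by (metis powr_powr powr_realpow)
  also have "\<dots> = (S powr b) ^ n"
    using assms by (metis mult.commute powr_gt_zero powr_powr powr_realpow)
  finally show ?thesis .
qed

text \<open>The form shared by both lower bounds: \<open>G\<close> is the optimal ranking in one
  case and the first hitting times of a guess sequence in the other. The support has at most
  \<open>CARD('x) ^ n\<close> elements, so the logarithm in the denominator is only linear in
  \<open>n\<close>.\<close>

lemma guessing_moment_seqs_ge:
  fixes p :: "'x::finite pmf" and G :: "'x list \<Rightarrow> nat"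
  defines "T \<equiv> \<lambda>n. {xs\<in>seqs n. prod_prob p xs > 0}"
  assumes \<rho>: "\<rho> > 0" and G: "inj_on G (T n)" "\<And>xs. xs \<in> T n \<Longrightarrow> G xs \<ge> 1"
  shows "((\<Sum>x\<in>UNIV. pmf p x powr (1 / (1 + \<rho>))) powr (1 + \<rho>)) ^ n
      / (2 + real n * ln (real CARD('x))) powr \<rho>
    \<le> (\<Sum>xs\<in>T n. prod_prob p xs * real (G xs) powr \<rho>)"
proof -
  define S where "S = (\<Sum>x\<in>UNIV. pmf p x powr (1 / (1 + \<rho>)))"
  have S: "S > 0" unfolding S_def by (rule sum_pmf_powr_pos)
  have sum: "(\<Sum>xs\<in>T n. prod_prob p xs powr (1 / (1 + \<rho>))) = S ^ n"
    unfolding T_def S_def by (rule sum_prod_prob_powr_support)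
  have ne: "T n \<noteq> {}"
  proof
    assume "T n = {}"
    then show False using sum S by simp
  qed
  have "card (T n) \<le> card (seqs n :: 'x list set)"
    unfolding T_def by (intro card_mono) auto
  then have "card (T n) \<le> CARD('x) ^ n" by (simp add: card_seqs)
  then have "(S ^ n) powr (1 + \<rho>) / (2 + ln (real (CARD('x) ^ n))) powr \<rho>
    \<le> (\<Sum>xs\<in>T n. prod_prob p xs * real (G xs) powr \<rho>)"
    unfolding sum[symmetric]
    by (intro guessing_moment_ge ne \<rho> G) (simp_all add: T_def)
  moreover have "(S ^ n) powr (1 + \<rho>) = (S powr (1 + \<rho>)) ^ n"
    by (rule power_powr_swap[OF S])
  ultimately show ?thesis by (simp add: S_def ln_realpow)
qed

text \<open>After taking logarithms and dividing by \<open>n\<close>, the polynomial denominator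
  costs \<open>O(ln n / n)\<close> and the constant \<open>C\<close> costs
  \<open>O(1 / n)\<close>.\<close>

lemma tendsto_ln_div_squeeze:
  fixes f :: "nat \<Rightarrow> real"
  assumes B: "B > 0" and K: "K \<ge> 0" and C: "C > 0"
    and lo: "\<And>n. B ^ n / (2 + real n * K) powr \<rho> \<le> f n"
    and up: "\<And>n. f n \<le> C * B ^ n"
  shows "(\<lambda>n. ln (f n) / real n) \<longlonglongrightarrow> ln B"
proof (rule tendsto_sandwich)
  have D: "2 + real n * K > 0" for n using K by (simp add: add_pos_nonneg)
  have lower: "0 < B ^ n / (2 + real n * K) powr \<rho>" for n
    using B D[of n] by simp
  have f: "f n > 0" for n using lower[of n] lo[of n] by linarith
  show "\<forall>\<^sub>F n in sequentially. ln B - \<rho> * (ln (2 + real n * K) / real n) \<le> ln (f n) / real n"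
  proof (rule eventually_sequentiallyI[of 1])
    fix n :: nat assume n: "1 \<le> n"
    have "ln (B ^ n / (2 + real n * K) powr \<rho>) \<le> ln (f n)"
      using lower[of n] lo[of n] f[of n] by simp
    then have "real n * ln B - \<rho> * ln (2 + real n * K) \<le> ln (f n)"
      using B D[of n] by (simp add: ln_div ln_realpow ln_powr)
    then have "(real n * ln B - \<rho> * ln (2 + real n * K)) / real n \<le> ln (f n) / real n"
      by (rule divide_right_mono) simp
    then show "ln B - \<rho> * (ln (2 + real n * K) / real n) \<le> ln (f n) / real n"
      using n by (simp add: diff_divide_distrib)
  qed
  show "\<forall>\<^sub>F n in sequentially. ln (f n) / real n \<le> ln B + ln C / real n"
  proof (rule eventually_sequentiallyI[of 1])
    fix n :: nat assume n: "1 \<le> n"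
    have "ln (f n) \<le> ln (C * B ^ n)"
      using up[of n] f[of n] B C by simp
    then have "ln (f n) \<le> ln C + real n * ln B"
      using B C by (simp add: ln_mult ln_realpow)
    then show "ln (f n) / real n \<le> ln B + ln C / real n"
      using n by (simp add: field_simps)
  qed
  have "(\<lambda>n. ln (2 + real n * K) / real n) \<longlonglongrightarrow> 0"
  \<comment> \<open>In the applications \<open>K = ln CARD('x)\<close>, which vanishes for a
    one-letter alphabet; the two cases have different asymptotics.\<close>
  proof (cases "K = 0")
    case True
    then show ?thesis by simp real_asymp
  next
    case False
    then have "K > 0" using K by simp
    then show ?thesis by real_asymp
  qed
  from tendsto_diff[OF tendsto_const tendsto_mult[OF tendsto_const this], of "ln B" \<rho>]
  show "(\<lambda>n. ln B - \<rho> * (ln (2 + real n * K) / real n)) \<longlonglongrightarrow> ln B" by simp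
  show "(\<lambda>n. ln B + ln C / real n) \<longlonglongrightarrow> ln B" by real_asymp
qed

section \<open>Bounds for the optimal ranking\<close>

lemma opt_ranking_cost_ge:
  fixes p :: "'x::finite pmf"
  assumes \<rho>: "\<rho> > 0" and g: "optimal_ranking p n g"
  shows "((\<Sum>x\<in>UNIV. pmf p x powr (1 / (1 + \<rho>))) powr (1 + \<rho>)) ^ n
      / (2 + real n * ln (real CARD('x))) powr \<rho> \<le> opt_ranking_cost p \<rho> n g"
proof -
  have bij: "bij_betw g (seqs n) {1..card (seqs n :: 'x list set)}"
    using g by (simp add: optimal_ranking_def)
  have "((\<Sum>x\<in>UNIV. pmf p x powr (1 / (1 + \<rho>))) powr (1 + \<rho>)) ^ n
      / (2 + real n * ln (real CARD('x))) powr \<rho>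
    \<le> (\<Sum>xs\<in>{xs\<in>seqs n. prod_prob p xs > 0}. prod_prob p xs * real (g xs) powr \<rho>)"
  proof (rule guessing_moment_seqs_ge[OF \<rho>])
    show "inj_on g {xs \<in> seqs n. 0 < prod_prob p xs}"
      using bij_betw_imp_inj_on[OF bij] by (rule inj_on_subset) auto
    show "1 \<le> g xs" if "xs \<in> {xs \<in> seqs n. 0 < prod_prob p xs}" for xs
      using bij_betwE[OF bij] that by auto
  qed
  also have "\<dots> \<le> opt_ranking_cost p \<rho> n g"
    unfolding opt_ranking_cost_def by (rule sum_mono2) auto
  finally show ?thesis .
qed

text \<open>Every sequence ranked no later than \<open>xs\<close> contributes at least \<open>1\<close> to the sum over \<open>ys\<close> of
  \<open>(P ys / P xs) powr (1 / (1 + \<rho>))\<close>, so this sum bounds the rank of \<open>xs\<close>.\<close>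

lemma optimal_ranking_le:
  fixes p :: "'x::finite pmf"
  assumes a: "a > 0" and g: "optimal_ranking p n g"
    and xs: "xs \<in> seqs n" "prod_prob p xs > 0"
  shows "real (g xs) * prod_prob p xs powr a \<le> (\<Sum>x\<in>UNIV. pmf p x powr a) ^ n"
proof -
  have bij: "bij_betw g (seqs n) {1..card (seqs n :: 'x list set)}"
    using g by (simp add: optimal_ranking_def)
  define L where "L = {ys \<in> seqs n. g ys \<le> g xs}"
  have "g xs \<in> {1..card (seqs n :: 'x list set)}" using bij_betwE[OF bij] xs by auto
  \<comment> \<open>Surjectivity of \<open>g\<close> onto an initial segment of the positive
    integers makes the rank of \<open>xs\<close> the number of sequences ranked no later than
    it.\<close>
  then have "g ` L = {1..g xs}"
    using bij_betw_imp_surj_on[OF bij] by (fastforce simp: L_def image_iff)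
  moreover have "inj_on g L"
    using bij_betw_imp_inj_on[OF bij] by (rule inj_on_subset) (auto simp: L_def)
  ultimately have "g xs = card L" by (metis card_atLeastAtMost card_image diff_Suc_1)
  have "real (g xs) * prod_prob p xs powr a = (\<Sum>ys\<in>L. prod_prob p xs powr a)"
    by (simp add: \<open>g xs = card L\<close>)
  also have "\<dots> \<le> (\<Sum>ys\<in>L. prod_prob p ys powr a)"
  proof (intro sum_mono powr_mono2)
    fix ys assume "ys \<in> L"
    then have ys: "ys \<in> seqs n" "g ys \<le> g xs" by (auto simp: L_def)
    show "prod_prob p xs \<le> prod_prob p ys"
    proof (cases "g ys < g xs")
      case True
      then show ?thesis using g xs ys by (simp add: optimal_ranking_def)
    next
      case False
      then have "ys = xs" using bij_betw_imp_inj_on[OF bij] ys xs by (simp add: inj_on_def)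
      then show ?thesis by simp
    qed
  qed (use a in auto)
  also have "\<dots> \<le> (\<Sum>ys\<in>seqs n. prod_prob p ys powr a)"
    by (intro sum_mono2) (auto simp: L_def)
  finally show ?thesis by (simp add: sum_prod_prob_powr)
qed

text \<open>With \<open>a = 1 / (1 + \<rho>)\<close> one has \<open>1 - a * \<rho> = a\<close>.
  Hence \<open>P * (S ^ n / P powr a) powr \<rho>\<close> is
  \<open>(S ^ n) powr \<rho> * P powr a\<close>, and summing \<open>P powr a\<close> supplies one
  more factor \<open>S ^ n\<close>. Both upper bounds use it: \<open>c\<close> is a power of the
  rank, or a bound for the moment of the guessing time.\<close>

lemma tilted_moment_le:
  fixes p :: "'x::finite pmf" and c :: "'x list \<Rightarrow> real"
  defines "S \<equiv> \<lambda>\<rho>. \<Sum>x\<in>UNIV. pmf p x powr (1 / (1 + \<rho>))"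
  assumes \<rho>: "\<rho> > 0" and K: "K \<ge> 0"
    and c: "\<And>xs. xs \<in> seqs n \<Longrightarrow> prod_prob p xs > 0 \<Longrightarrow>
      c xs \<le> K * (S \<rho> ^ n / prod_prob p xs powr (1 / (1 + \<rho>))) powr \<rho>"
  shows "(\<Sum>xs\<in>seqs n. prod_prob p xs * c xs) \<le> K * (S \<rho> powr (1 + \<rho>)) ^ n"
proof -
  have S: "S \<rho> > 0" unfolding S_def by (rule sum_pmf_powr_pos)
  have "prod_prob p xs * c xs \<le> K * (S \<rho> ^ n) powr \<rho> * prod_prob p xs powr (1 / (1 + \<rho>))"
    if xs: "xs \<in> seqs n" for xs
  proof (cases "prod_prob p xs > 0")
    case True
    define P where "P = prod_prob p xs"
    have P: "P > 0" using True by (simp add: P_def)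
    have "1 - \<rho> / (1 + \<rho>) = 1 / (1 + \<rho>)" using \<rho> by (simp add: field_simps)
    then have "P / P powr (\<rho> / (1 + \<rho>)) = P powr (1 / (1 + \<rho>))"
      using powr_diff[of P 1 "\<rho> / (1 + \<rho>)"] P by simp
    moreover have "P * (S \<rho> ^ n / P powr (1 / (1 + \<rho>))) powr \<rho>
        = (S \<rho> ^ n) powr \<rho> * (P / P powr (\<rho> / (1 + \<rho>)))"
      using P S by (subst powr_divide) (simp_all add: powr_powr)
    ultimately have "P * (S \<rho> ^ n / P powr (1 / (1 + \<rho>))) powr \<rho>
        = (S \<rho> ^ n) powr \<rho> * P powr (1 / (1 + \<rho>))" by simp
    then show ?thesis
      using mult_left_mono[OF c[OF xs True], of P] P by (simp add: P_def mult_ac)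
  next
    case False
    then have "prod_prob p xs = 0" using prod_prob_nonneg[of p xs] by linarith
    then show ?thesis by simp
  qed
  then have "(\<Sum>xs\<in>seqs n. prod_prob p xs * c xs)
      \<le> K * (S \<rho> ^ n) powr \<rho> * (\<Sum>xs\<in>seqs n. prod_prob p xs powr (1 / (1 + \<rho>)))"
    unfolding sum_distrib_left by (rule sum_mono)
  also have "\<dots> = K * (S \<rho> ^ n) powr (1 + \<rho>)"
    using S by (simp add: sum_prod_prob_powr S_def powr_add)
  also have "(S \<rho> ^ n) powr (1 + \<rho>) = (S \<rho> powr (1 + \<rho>)) ^ n"
    by (rule power_powr_swap[OF S])
  finally show ?thesis .
qed

text \<open>The factor \<open>1\<close> keeps the shape \<open>C * B ^ n\<close> that the squeeze
  expects.\<close>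

lemma opt_ranking_cost_le:
  fixes p :: "'x::finite pmf"
  assumes \<rho>: "\<rho> > 0" and g: "optimal_ranking p n g"
  shows "opt_ranking_cost p \<rho> n g
    \<le> 1 * ((\<Sum>x\<in>UNIV. pmf p x powr (1 / (1 + \<rho>))) powr (1 + \<rho>)) ^ n"
  unfolding opt_ranking_cost_def
proof (rule tilted_moment_le[OF \<rho>])
  fix xs :: "'x list" assume xs: "xs \<in> seqs n" "0 < prod_prob p xs"
  have "real (g xs) \<le> (\<Sum>x\<in>UNIV. pmf p x powr (1 / (1 + \<rho>))) ^ n / prod_prob p xs powr (1 / (1 + \<rho>))"
    using optimal_ranking_le[OF _ g xs, of "1 / (1 + \<rho>)"] \<rho> xs by (simp add: field_simps)
  then show "real (g xs) powr \<rho>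
    \<le> 1 * ((\<Sum>x\<in>UNIV. pmf p x powr (1 / (1 + \<rho>))) ^ n / prod_prob p xs powr (1 / (1 + \<rho>))) powr \<rho>"
    using \<rho> by (simp add: powr_mono2)
qed simp

section \<open>Measurability of guesses and the lower bound for strategies\<close>

lemma measurable_guess:
  assumes "\<mu> \<in> strategies A n" "a \<in> A"
  shows "(\<lambda>w. w a k) \<in> PiM A \<mu> \<rightarrow>\<^sub>M count_space (seqs n)"
proof -
  have component: "(\<lambda>w. w a) \<in> PiM A \<mu> \<rightarrow>\<^sub>M \<mu> a"
    using assms(2) by (rule measurable_component_singleton)
  have "sets (\<mu> a) = sets (PiM UNIV (\<lambda>_. count_space (seqs n)))"
    using assms by (simp add: strategies_def)
  then have "(\<lambda>v. v k) \<in> \<mu> a \<rightarrow>\<^sub>M count_space (seqs n)"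
    by (simp cong: measurable_cong_sets)
  with component show ?thesis by (rule measurable_compose)
qed

lemma pred_guess_eq:
  assumes "\<mu> \<in> strategies A n" "a \<in> A"
  shows "Measurable.pred (PiM A \<mu>) (\<lambda>w. w a k = xs)"
  by (rule measurable_compose[OF measurable_guess[OF assms]]) simp

lemma measurable_guess_pow:
  assumes \<mu>: "\<mu> \<in> strategies A n" and \<pi>: "\<And>i. fst (\<pi> i) \<in> A"
  shows "(\<lambda>w. guess_pow \<rho> \<pi> w xs) \<in> borel_measurable (PiM A \<mu>)"
proof -
  have [measurable]: "Measurable.pred (PiM A \<mu>) (\<lambda>w. w (fst (\<pi> i)) (snd (\<pi> i)) = xs)" for i
    by (rule pred_guess_eq[OF \<mu> \<pi>])
  \<comment> \<open>The least hitting index is a measurable map into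
    \<open>count_space UNIV\<close>; this fact covers the function applied to it.\<close>
  have [measurable]: "(\<lambda>i. ennreal (real (Suc i) powr \<rho>)) \<in> count_space UNIV \<rightarrow>\<^sub>M borel"
    by simp
  show ?thesis unfolding guess_pow_def by measurable
qed

lemma prob_space_strategies:
  "\<mu> \<in> strategies A n \<Longrightarrow> prob_space (PiM A \<mu>)"
  by (rule prob_space_PiM) (simp add: strategies_def)

text \<open>The bound holds for each realisation \<open>w\<close>. If some sequence of positive
  probability is never guessed, the sum is infinite. Otherwise the first hitting times are distinct,
  because a single position holds only one guess, and the moment bound applies to them.\<close>

lemma guess_pow_sum_ge:
  fixes p :: "'x::finite pmf"
  assumes \<rho>: "\<rho> > 0"
  shows "ennreal (((\<Sum>x\<in>UNIV. pmf p x powr (1 / (1 + \<rho>))) powr (1 + \<rho>)) ^ n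
      / (2 + real n * ln (real CARD('x))) powr \<rho>)
    \<le> (\<Sum>xs\<in>seqs n. ennreal (prod_prob p xs) * guess_pow \<rho> \<pi> w xs)"
proof -
  define T where "T = {xs\<in>seqs n. prod_prob p xs > 0}"
  define h where "h i = w (fst (\<pi> i)) (snd (\<pi> i))" for i
  have T: "finite T" "T \<subseteq> seqs n" by (auto simp: T_def)
  have pow: "guess_pow \<rho> \<pi> w xs = (if \<exists>i. h i = xs
      then ennreal (real (Suc (LEAST i. h i = xs)) powr \<rho>) else \<infinity>)" for xs
    by (simp add: guess_pow_def h_def)
  show ?thesis
  proof (cases "\<forall>xs\<in>T. \<exists>i. h i = xs")
    case True
    define G where "G xs = Suc (LEAST i. h i = xs)" for xs
    have hit: "h (LEAST i. h i = xs) = xs" if "xs \<in> T" for xs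
      using True that by (metis (mono_tags) LeastI)
    have "inj_on G T"
      by (rule inj_onI) (metis G_def hit nat.inject)
    then have "((\<Sum>x\<in>UNIV. pmf p x powr (1 / (1 + \<rho>))) powr (1 + \<rho>)) ^ n
      / (2 + real n * ln (real CARD('x))) powr \<rho>
      \<le> (\<Sum>xs\<in>T. prod_prob p xs * real (G xs) powr \<rho>)"
      unfolding T_def by (rule guessing_moment_seqs_ge[OF \<rho>]) (simp add: G_def)
    then have "ennreal (((\<Sum>x\<in>UNIV. pmf p x powr (1 / (1 + \<rho>))) powr (1 + \<rho>)) ^ n
      / (2 + real n * ln (real CARD('x))) powr \<rho>)
      \<le> ennreal (\<Sum>xs\<in>T. prod_prob p xs * real (G xs) powr \<rho>)"
      by (rule ennreal_leI)
    also have "\<dots> = (\<Sum>xs\<in>T. ennreal (prod_prob p xs) * guess_pow \<rho> \<pi> w xs)"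
      using True by (subst sum_ennreal[symmetric]) (auto simp: pow G_def ennreal_mult intro!: sum.cong)
    also have "\<dots> \<le> (\<Sum>xs\<in>seqs n. ennreal (prod_prob p xs) * guess_pow \<rho> \<pi> w xs)"
      using T by (intro sum_mono2) auto
    finally show ?thesis .
  next
    case False
    then obtain xs where xs: "xs \<in> seqs n" "prod_prob p xs > 0" "\<nexists>i. h i = xs"
      by (auto simp: T_def)
    then have "ennreal (prod_prob p xs) * guess_pow \<rho> \<pi> w xs = \<infinity>"
      by (simp add: pow ennreal_mult_top)
    then have "(\<Sum>xs\<in>seqs n. ennreal (prod_prob p xs) * guess_pow \<rho> \<pi> w xs) = \<infinity>"
      using xs(1) by (subst sum.remove[of _ xs]) auto
    then show ?thesis by (metis top_greatest infinity_ennreal_def)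
  qed
qed

text \<open>Averaging over the guesses preserves a bound that holds for every realisation, so
  randomisation cannot beat it.\<close>

lemma strategy_cost_ge:
  fixes p :: "'x::finite pmf"
  assumes \<rho>: "\<rho> > 0" and \<mu>: "\<mu> \<in> strategies A n" and \<pi>: "\<And>i. fst (\<pi> i) \<in> A"
  shows "ennreal (((\<Sum>x\<in>UNIV. pmf p x powr (1 / (1 + \<rho>))) powr (1 + \<rho>)) ^ n
      / (2 + real n * ln (real CARD('x))) powr \<rho>) \<le> strategy_cost A p \<rho> n \<mu> \<pi>"
    (is "?lb \<le> _")
proof -
  interpret prob_space "PiM A \<mu>" by (rule prob_space_strategies[OF \<mu>])
  note [measurable] = measurable_guess_pow[OF \<mu> \<pi>]
  have "?lb = (\<integral>\<^sup>+ w. ?lb \<partial>PiM A \<mu>)" by (simp add: emeasure_space_1)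
  also have "\<dots> \<le> (\<integral>\<^sup>+ w. (\<Sum>xs\<in>seqs n. ennreal (prod_prob p xs) * guess_pow \<rho> \<pi> w xs) \<partial>PiM A \<mu>)"
    by (intro nn_integral_mono guess_pow_sum_ge[OF \<rho>])
  also have "\<dots> = strategy_cost A p \<rho> n \<mu> \<pi>"
    by (simp add: strategy_cost_def nn_integral_sum nn_integral_cmult)
  finally show ?thesis .
qed

lemma opt_value_ge:
  fixes p :: "'x::finite pmf" and A :: "'a set"
  assumes \<rho>: "\<rho> > 0" and A: "countable A" "A \<noteq> {}"
  shows "ennreal (((\<Sum>x\<in>UNIV. pmf p x powr (1 / (1 + \<rho>))) powr (1 + \<rho>)) ^ n
      / (2 + real n * ln (real CARD('x))) powr \<rho>) \<le> opt_value A p \<rho> n"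
  unfolding opt_value_def
proof (rule INF_greatest)
  fix \<mu> :: "'a \<Rightarrow> (nat \<Rightarrow> 'x list) measure" assume \<mu>: "\<mu> \<in> strategies A n"
  \<comment> \<open>Some interleaving has to exist, since the supremum over an empty set would be
    \<open>0\<close>. Enumerating the countably infinite set of pairs gives one, and one suffices
    because the lower bound holds for any.\<close>
  have "infinite (A \<times> (UNIV :: nat set))" using A by (auto simp: finite_cartesian_product_iff)
  then have \<pi>: "bij_betw (from_nat_into (A \<times> UNIV)) UNIV (A \<times> (UNIV :: nat set))"
    using A by (intro bij_betw_from_nat_into) auto
  have "fst (from_nat_into (A \<times> (UNIV :: nat set)) i) \<in> A" for i
    using bij_betwE[OF \<pi>] by (auto simp: mem_Times_iff)
  from strategy_cost_ge[OF \<rho> \<mu> this] \<pi>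
  show "ennreal (((\<Sum>x\<in>UNIV. pmf p x powr (1 / (1 + \<rho>))) powr (1 + \<rho>)) ^ n
      / (2 + real n * ln (real CARD('x))) powr \<rho>)
    \<le> (SUP \<pi>\<in>{\<pi>. bij_betw \<pi> UNIV (A \<times> UNIV)}. strategy_cost A p \<rho> n \<mu> \<pi>)"
    by (intro SUP_upper2) auto
qed

section \<open>Upper bound by independent, identically distributed guesses\<close>

text \<open>Any interleaving of independent sequences with common law \<open>M\<close> is again
  i.i.d. The constraints on the first \<open>m\<close> positions are grouped by agent, the cylinder
  formula is applied to each inner product and then to the outer one, and the products are merged
  again. Injectivity of \<open>\<pi>\<close> ensures that no coordinate is constrained
  twice.\<close>

lemma emeasure_PiM_PiM_Collect:
  fixes \<pi> :: "nat \<Rightarrow> 'a \<times> 'b" and A :: "'a set" and M :: "'c measure"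
  defines "N \<equiv> PiM A (\<lambda>_. PiM UNIV (\<lambda>_. M))"
  assumes M: "prob_space M" and \<pi>: "inj \<pi>" "\<And>i. fst (\<pi> i) \<in> A"
    and E: "\<And>j. E j \<in> sets M"
  shows "emeasure N {w\<in>space N. \<forall>j<m. w (fst (\<pi> j)) (snd (\<pi> j)) \<in> E j}
    = (\<Prod>j<m. emeasure M (E j))"
proof -
  define L :: "('b \<Rightarrow> 'c) measure" where "L = PiM UNIV (\<lambda>_. M)"
  interpret L: product_prob_space "\<lambda>_. M" "UNIV :: 'b set" using M by (intro product_prob_spaceI)
  interpret N: product_prob_space "\<lambda>_. L" A
    unfolding L_def by (intro product_prob_spaceI L.prob_space_axioms)
  \<comment> \<open>The pairs used in the first \<open>m\<close> positions decompose as
    \<open>Sigma I K\<close>; \<open>X a\<close> is the cylinder of all constraints on agent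
    \<open>a\<close>.\<close>
  define J where "J = \<pi> ` {..<m}"
  define F where "F c = E (inv \<pi> c)" for c
  define I where "I = fst ` J"
  define K where "K a = {k. (a, k) \<in> J}" for a
  define X where "X a = {v\<in>space L. \<forall>k\<in>K a. v k \<in> F (a, k)}" for a
  have J: "J = Sigma I K" by (force simp: I_def K_def)
  have fin: "finite J" "finite I" by (auto simp: J_def I_def)
  have finK: "finite (K a)" for a
    by (rule finite_subset[of _ "snd ` J"]) (use fin in \<open>force simp: K_def\<close>)+
  have F: "F c \<in> sets M" for c by (simp add: F_def E)
  have IA: "I \<subseteq> A" using \<pi>(2) by (auto simp: I_def J_def)
  have X: "X a \<in> sets L" for a
    unfolding X_def
  proof (rule sets.sets_Collect_finite_All)
    fix k assume "k \<in> K a"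
    show "{v \<in> space L. v k \<in> F (a, k)} \<in> sets L"
      using F[of "(a, k)"] unfolding L_def by measurable
  qed (rule finK)
  have emX: "emeasure L (X a) = (\<Prod>k\<in>K a. emeasure M (F (a, k)))" for a
    unfolding X_def L_def using finK F by (intro L.emeasure_PiM_Collect) auto
  \<comment> \<open>\<open>X a\<close> also demands membership in \<open>space L\<close>, which is
    automatic for \<open>a \<in> I\<close> because \<open>I \<subseteq> A\<close> and
    \<open>w\<close> lies in \<open>space N\<close>.\<close>
  have "(\<forall>j<m. w (fst (\<pi> j)) (snd (\<pi> j)) \<in> E j) \<longleftrightarrow> (\<forall>a\<in>I. w a \<in> X a)"
    if "w \<in> space N" for w
  proof -
    have "(\<forall>j<m. w (fst (\<pi> j)) (snd (\<pi> j)) \<in> E j) \<longleftrightarrow> (\<forall>c\<in>J. w (fst c) (snd c) \<in> F c)"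
      using \<pi>(1) by (auto simp: J_def F_def)
    also have "\<dots> \<longleftrightarrow> (\<forall>a\<in>I. w a \<in> X a)"
      unfolding J using that IA by (auto simp: X_def N_def L_def space_PiM PiE_def Pi_def)
    finally show ?thesis .
  qed
  then have "emeasure N {w\<in>space N. \<forall>j<m. w (fst (\<pi> j)) (snd (\<pi> j)) \<in> E j}
    = emeasure N {w\<in>space N. \<forall>a\<in>I. w a \<in> X a}"
    by (intro arg_cong[where f = "emeasure N"]) blast
  also have "\<dots> = (\<Prod>a\<in>I. emeasure L (X a))"
    unfolding N_def L_def[symmetric] using IA fin X by (intro N.emeasure_PiM_Collect) auto
  also have "\<dots> = (\<Prod>c\<in>J. emeasure M (F c))"
    unfolding J emX by (subst prod.Sigma) (use fin finK in \<open>auto simp: case_prod_unfold\<close>)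
  also have "\<dots> = (\<Prod>j<m. emeasure M (E j))"
    unfolding J_def using \<pi>(1) by (subst prod.reindex) (auto simp: F_def inj_on_def)
  finally show ?thesis .
qed

text \<open>Raise \<open>t \<le> exp t\<close> at \<open>t = y / (2 * \<rho>)\<close> to the power
  \<open>\<rho>\<close>. The exponent \<open>y / 2\<close> consumes only half of the exponential
  decay of a geometric law.\<close>

lemma powr_le_exp_half:
  assumes "y > (0::real)" "\<rho> > 0"
  shows "y powr \<rho> \<le> (2 * \<rho>) powr \<rho> * exp (y / 2)"
proof -
  have "y / (2 * \<rho>) \<le> exp (y / (2 * \<rho>))"
    using exp_ge_add_one_self[of "y / (2 * \<rho>)"] by linarith
  then have "(y / (2 * \<rho>)) powr \<rho> \<le> exp (y / (2 * \<rho>)) powr \<rho>"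
    using assms by (intro powr_mono2) auto
  also have "\<dots> = exp (y / 2)" using assms by (simp add: exp_powr_real)
  finally show ?thesis using assms by (simp add: powr_divide field_simps)
qed

text \<open>Taking \<open>y = q * (i + 1)\<close> in \<open>powr_le_exp_half\<close> extracts the
  factor \<open>(1 / q) powr \<rho>\<close> and leaves a geometric series of ratio
  \<open>exp (- q / 2)\<close>. Its sum is of order \<open>1 / q\<close>, which the factor
  \<open>q\<close> of the geometric weights absorbs.\<close>

lemma geometric_moment_le:
  fixes q \<rho> :: real
  assumes q: "0 < q" "q \<le> 1" and \<rho>: "\<rho> > 0"
  shows "(\<Sum>i. ennreal (real (Suc i) powr \<rho> * (q * (1 - q) ^ i)))
    \<le> ennreal (6 * (2 * \<rho>) powr \<rho> * (1 / q) powr \<rho>)"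
proof -
  define r where "r = exp (- q / 2)"
  define c where "c = (2 * \<rho>) powr \<rho> * (1 / q) powr \<rho> * (q * exp (q / 2))"
  have r: "0 < r" "r < 1" using q by (auto simp: r_def)
  have c: "c \<ge> 0" using q by (simp add: c_def)
  have le: "real (Suc i) powr \<rho> * (q * (1 - q) ^ i) \<le> c * r ^ i" for i
  proof -
    have "real (Suc i) powr \<rho> = (1 / q) powr \<rho> * (q * real (Suc i)) powr \<rho>"
      using q by (simp add: powr_mult[symmetric])
    also have "\<dots> \<le> (1 / q) powr \<rho> * ((2 * \<rho>) powr \<rho> * exp (q * real (Suc i) / 2))"
      using q \<rho> by (intro mult_left_mono powr_le_exp_half) auto
    finally have 1: "real (Suc i) powr \<rho>
      \<le> (1 / q) powr \<rho> * ((2 * \<rho>) powr \<rho> * exp (q * real (Suc i) / 2))" .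
    have "1 - q \<le> exp (- q)" using exp_ge_add_one_self[of "- q"] by simp
    then have "(1 - q) ^ i \<le> exp (- q) ^ i" using q by (intro power_mono) auto
    then have 2: "q * (1 - q) ^ i \<le> q * exp (- q * real i)"
      using q by (simp add: exp_of_nat_mult[symmetric] mult.commute)
    have "real (Suc i) powr \<rho> * (q * (1 - q) ^ i)
      \<le> (1 / q) powr \<rho> * ((2 * \<rho>) powr \<rho> * exp (q * real (Suc i) / 2)) * (q * exp (- q * real i))"
      using q by (intro mult_mono 1 2) auto
    also have "\<dots> = (2 * \<rho>) powr \<rho> * (1 / q) powr \<rho> * q
        * (exp (q * real (Suc i) / 2) * exp (- q * real i))"
      by (simp add: mult_ac)
    also have "exp (q * real (Suc i) / 2) * exp (- q * real i) = exp (q / 2) * exp (real i * (- q / 2))"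
      by (simp add: exp_add[symmetric] field_simps)
    also have "(2 * \<rho>) powr \<rho> * (1 / q) powr \<rho> * q * (exp (q / 2) * exp (real i * (- q / 2))) = c * r ^ i"
      unfolding exp_of_nat_mult by (simp add: c_def r_def mult_ac)
    finally show ?thesis .
  qed
  have sums: "(\<lambda>i. c * r ^ i) sums (c * (1 / (1 - r)))"
    using r by (intro sums_mult geometric_sums) auto
  have "(\<Sum>i. ennreal (real (Suc i) powr \<rho> * (q * (1 - q) ^ i))) \<le> (\<Sum>i. ennreal (c * r ^ i))"
    by (intro suminf_le ennreal_leI le) auto
  also have "\<dots> = ennreal (c * (1 / (1 - r)))"
    using sums_unique[OF sums] sums_summable[OF sums] c r by (subst suminf_ennreal2) auto
  also have "c * (1 / (1 - r)) \<le> 6 * (2 * \<rho>) powr \<rho> * (1 / q) powr \<rho>"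
  proof -
    \<comment> \<open>Source of the \<open>6\<close>: \<open>q * exp (q / 2)\<close> is at most
      \<open>2 * exp q * (1 - r)\<close>, and \<open>exp q \<le> exp 1 \<le> 3\<close>.\<close>
    have "q = 2 * ((1 + q / 2) - 1)" by simp
    also have "\<dots> \<le> 2 * (exp (q / 2) - 1)"
      by (intro mult_left_mono diff_right_mono exp_ge_add_one_self) simp
    finally have "q \<le> 2 * (exp (q / 2) - 1)" .
    then have "q * exp (q / 2) \<le> 2 * (exp (q / 2) - 1) * exp (q / 2)"
      by (intro mult_right_mono) auto
    also have "\<dots> = 2 * exp q * (1 - r)"
      by (simp add: r_def algebra_simps exp_add[symmetric])
    also have "\<dots> \<le> 6 * (1 - r)"
    proof -
      have "exp q \<le> exp 1" using q by simp
      also have "\<dots> \<le> 3" by (rule exp_le)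
      finally show ?thesis using r by (intro mult_right_mono) auto
    qed
    finally have "q * exp (q / 2) / (1 - r) \<le> 6" using r by (simp add: field_simps)
    then have "(2 * \<rho>) powr \<rho> * (1 / q) powr \<rho> * (q * exp (q / 2) / (1 - r))
      \<le> (2 * \<rho>) powr \<rho> * (1 / q) powr \<rho> * 6"
      by (intro mult_left_mono) auto
    then show ?thesis by (simp add: c_def mult_ac)
  qed
  finally show ?thesis by (simp add: ennreal_leI)
qed

text \<open>Whatever the interleaving, the first hit of \<open>x\<close> occurs at index
  \<open>i\<close> with probability \<open>q * (1 - q) ^ i\<close>, so the integral reduces to a
  geometric moment.\<close>

lemma nn_integral_guess_pow_le:
  fixes \<pi> :: "nat \<Rightarrow> 'a \<times> nat" and A :: "'a set" and M :: "'y measure"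
  defines "N \<equiv> PiM A (\<lambda>_. PiM UNIV (\<lambda>_. M))"
  assumes M: "prob_space M" and \<pi>: "inj \<pi>" "\<And>i. fst (\<pi> i) \<in> A" and \<rho>: "\<rho> > 0"
    and x: "{x} \<in> sets M" and q: "0 < q" "measure M {x} = q"
  shows "(\<integral>\<^sup>+ w. guess_pow \<rho> \<pi> w x \<partial>N) \<le> ennreal (6 * (2 * \<rho>) powr \<rho> * (1 / q) powr \<rho>)"
proof -
  interpret M: prob_space M by fact
  interpret N: prob_space N unfolding N_def by (intro prob_space_PiM M)
  define h where "h i w = w (fst (\<pi> i)) (snd (\<pi> i))" for i and w :: "'a \<Rightarrow> nat \<Rightarrow> 'y"
  have h [measurable]: "h i \<in> N \<rightarrow>\<^sub>M M" for i
    unfolding h_def N_def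
    by (rule measurable_compose[OF measurable_component_singleton[OF \<pi>(2)]])
       (rule measurable_component_singleton, simp)
  have hs: "h i w \<in> space M" if "w \<in> space N" for i w
    using h that by (rule measurable_space)
  have q1: "q \<le> 1" using M.prob_le_1[of "{x}"] q by simp
  have ex: "emeasure M {x} = ennreal q" "emeasure M (space M - {x}) = ennreal (1 - q)"
    using q x by (simp_all add: M.emeasure_eq_measure M.prob_compl)
  have prob: "emeasure N {w\<in>space N. \<forall>j<m. h j w \<in> E j} = (\<Prod>j<m. emeasure M (E j))"
    if "\<And>j. E j \<in> sets M" for E m
    unfolding h_def N_def by (rule emeasure_PiM_PiM_Collect[OF M \<pi> that])
  define B where "B i = {w\<in>space N. (\<forall>j<i. h j w \<noteq> x) \<and> h i w = x}" for i
  have B: "B i \<in> sets N" "emeasure N (B i) = ennreal (q * (1 - q) ^ i)" for i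
  proof -
    define E where "E j = (if j < i then space M - {x} else {x})" for j
    have E: "E j \<in> sets M" for j using x by (auto simp: E_def)
    have eq: "B i = {w\<in>space N. \<forall>j<Suc i. h j w \<in> E j}"
      using hs by (auto simp: B_def E_def less_Suc_eq)
    show "B i \<in> sets N" unfolding eq using E by measurable
    have "(\<Prod>j<Suc i. emeasure M (E j)) = ennreal (1 - q) ^ i * ennreal q"
      by (simp add: E_def ex)
    then show "emeasure N (B i) = ennreal (q * (1 - q) ^ i)"
      unfolding eq prob[OF E] using q q1 by (simp add: ennreal_power ennreal_mult mult.commute)
  qed
  \<comment> \<open>On \<open>Z\<close> the value is infinite, so \<open>Z\<close> has to be null:
    it forces a miss at each of the first \<open>m\<close> positions, an event of probability
    \<open>(1 - q) ^ m\<close>, for every \<open>m\<close>.\<close>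
  define Z where "Z = {w\<in>space N. \<forall>i. h i w \<in> space M - {x}}"
  have Z: "Z \<in> sets N" unfolding Z_def using x by measurable
  have "emeasure N Z \<le> ennreal ((1 - q) ^ m)" for m
  proof -
    have "emeasure N Z \<le> emeasure N {w\<in>space N. \<forall>j<m. h j w \<in> space M - {x}}"
      using x by (intro emeasure_mono) (auto simp: Z_def, measurable)
    also have "\<dots> = (\<Prod>j<m. emeasure M (space M - {x}))"
      using x by (intro prob) auto
    finally show ?thesis using q1 by (simp add: ex ennreal_power)
  qed
  moreover have "(\<lambda>m. ennreal ((1 - q) ^ m)) \<longlonglongrightarrow> ennreal 0"
    using q q1 by (intro tendsto_ennrealI LIMSEQ_realpow_zero) auto
  ultimately have "emeasure N Z \<le> ennreal 0"
    by (intro LIMSEQ_le_const) auto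
  then have "AE w in N. \<exists>i. h i w = x"
    using Z hs by (intro AE_I[of _ _ Z]) (auto simp: Z_def)
  then have "(\<integral>\<^sup>+ w. guess_pow \<rho> \<pi> w x \<partial>N)
    \<le> (\<integral>\<^sup>+ w. (\<Sum>i. ennreal (real (Suc i) powr \<rho>) * indicator (B i) w) \<partial>N)"
  proof (intro nn_integral_mono_AE, elim AE_mp, intro AE_I2 impI)
    fix w assume w: "w \<in> space N" "\<exists>i. h i w = x"
    define l where "l = (LEAST i. h i w = x)"
    have "h l w = x" unfolding l_def using w(2) by (rule LeastI_ex)
    moreover have "h j w \<noteq> x" if "j < l" for j using not_less_Least[OF that[unfolded l_def]] .
    ultimately have "w \<in> B l" using w by (auto simp: B_def)
    have "guess_pow \<rho> \<pi> w x = ennreal (real (Suc l) powr \<rho>)"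
      using w(2) by (simp add: guess_pow_def l_def h_def)
    also have "\<dots> = (\<Sum>i\<in>{l}. ennreal (real (Suc i) powr \<rho>) * indicator (B i) w)"
      using \<open>w \<in> B l\<close> by simp
    also have "\<dots> \<le> (\<Sum>i. ennreal (real (Suc i) powr \<rho>) * indicator (B i) w)"
      by (intro sum_le_suminf) auto
    finally show "guess_pow \<rho> \<pi> w x
      \<le> (\<Sum>i. ennreal (real (Suc i) powr \<rho>) * indicator (B i) w)" .
  qed
  also have "\<dots> = (\<Sum>i. ennreal (real (Suc i) powr \<rho> * (q * (1 - q) ^ i)))"
    using B q q1 by (subst nn_integral_suminf) (auto simp: nn_integral_cmult ennreal_mult simp del: of_nat_Suc)
  also have "\<dots> \<le> ennreal (6 * (2 * \<rho>) powr \<rho> * (1 / q) powr \<rho>)"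
    by (rule geometric_moment_le[OF q(1) q1 \<rho>])
  finally show ?thesis .
qed

lemma opt_value_le:
  fixes p :: "'x::finite pmf" and A :: "'a set"
  assumes \<rho>: "\<rho> > 0"
  shows "opt_value A p \<rho> n \<le> ennreal (6 * (2 * \<rho>) powr \<rho> *
    ((\<Sum>x\<in>UNIV. pmf p x powr (1 / (1 + \<rho>))) powr (1 + \<rho>)) ^ n)"
proof -
  define S where "S = (\<Sum>x\<in>UNIV. pmf p x powr (1 / (1 + \<rho>)))"
  define K where "K = 6 * (2 * \<rho>) powr \<rho>"
  \<comment> \<open>\<open>S ^ n\<close> is the sum of these powers over all sequences, so
    \<open>Q\<close> is a probability mass function. Every agent draws from it.\<close>
  define Q where "Q xs = prod_prob p xs powr (1 / (1 + \<rho>)) / S ^ n" for xs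
  define M where "M = point_measure (seqs n) (\<lambda>xs. ennreal (Q xs))"
  define \<mu> :: "'a \<Rightarrow> (nat \<Rightarrow> 'x list) measure" where "\<mu> a = PiM UNIV (\<lambda>_. M)" for a
  have S: "S > 0" unfolding S_def by (rule sum_pmf_powr_pos)
  have Q: "Q xs \<ge> 0" for xs using S by (simp add: Q_def)
  have M: "prob_space M"
    unfolding M_def using S Q
    by (intro prob_space_point_measure)
       (auto simp: Q_def S_def sum_prod_prob_powr simp flip: sum_divide_distrib)
  have setsM: "sets M = sets (count_space (seqs n))" by (simp add: M_def sets_point_measure)
  have \<mu>: "\<mu> \<in> strategies A n"
    unfolding strategies_def \<mu>_def
    by (auto intro!: prob_space_PiM M sets_PiM_cong simp: setsM)
  have "strategy_cost A p \<rho> n \<mu> \<pi> \<le> ennreal (K * (S powr (1 + \<rho>)) ^ n)"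
    if "bij_betw \<pi> UNIV (A \<times> UNIV)" for \<pi>
  proof -
    define c where "c xs = K * (S ^ n / prod_prob p xs powr (1 / (1 + \<rho>))) powr \<rho>" for xs
    have \<pi>: "inj \<pi>" "fst (\<pi> i) \<in> A" for i
      using that bij_betwE[OF that] by (auto simp: bij_betw_def mem_Times_iff)
    have "ennreal (prod_prob p xs) * (\<integral>\<^sup>+ w. guess_pow \<rho> \<pi> w xs \<partial>PiM A \<mu>)
      \<le> ennreal (prod_prob p xs * c xs)" if xs: "xs \<in> seqs n" for xs
    proof (cases "prod_prob p xs > 0")
      case True
      have "measure M {xs} = Q xs"
        using xs Q unfolding M_def measure_def by (simp add: emeasure_point_measure_finite)
      moreover have "Q xs > 0" using True S by (simp add: Q_def)
      moreover have "{xs} \<in> sets M" using xs by (simp add: setsM)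
      ultimately have "(\<integral>\<^sup>+ w. guess_pow \<rho> \<pi> w xs \<partial>PiM A \<mu>) \<le> ennreal (K * (1 / Q xs) powr \<rho>)"
        unfolding \<mu>_def K_def by (intro nn_integral_guess_pow_le M \<pi> \<rho>)
      also have "K * (1 / Q xs) powr \<rho> = c xs" by (simp add: c_def Q_def)
      finally show ?thesis by (simp add: ennreal_mult' mult_left_mono)
    next
      \<comment> \<open>A null sequence also has \<open>Q xs = 0\<close>, so its integral may be
        infinite; the product is still \<open>0\<close> because \<open>0 * \<infinity> = 0\<close>
        in \<open>ennreal\<close>.\<close>
      case False
      then have "prod_prob p xs = 0" using prod_prob_nonneg[of p xs] by linarith
      then show ?thesis by simp
    qed
    then have "strategy_cost A p \<rho> n \<mu> \<pi> \<le> (\<Sum>xs\<in>seqs n. ennreal (prod_prob p xs * c xs))"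
      unfolding strategy_cost_def by (rule sum_mono)
    also have "\<dots> = ennreal (\<Sum>xs\<in>seqs n. prod_prob p xs * c xs)"
      by (intro sum_ennreal) (simp add: c_def K_def)
    also have "\<dots> \<le> ennreal (K * (S powr (1 + \<rho>)) ^ n)"
      unfolding S_def by (intro ennreal_leI tilted_moment_le \<rho>) (simp_all add: c_def S_def K_def)
    finally show ?thesis .
  qed
  then have "opt_value A p \<rho> n \<le> ennreal (K * (S powr (1 + \<rho>)) ^ n)"
    unfolding opt_value_def by (intro INF_lower2[OF \<mu>] SUP_least) simp
  then show ?thesis by (simp add: K_def S_def)
qed

section \<open>The two growth rates\<close>

theorem theorem1:
  fixes p :: "'x::finite pmf" and \<rho> :: real and A :: "'a set"
    and g :: "nat \<Rightarrow> 'x list \<Rightarrow> nat"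
  assumes "\<rho> > 0" and "countable A" and "A \<noteq> {}"
    and "\<forall>n. optimal_ranking p n (g n)"
  shows "eventually (\<lambda>n. opt_value A p \<rho> n < \<infinity>) sequentially
    \<and> (\<lambda>n. ln (enn2real (opt_value A p \<rho> n)) / real n)
        \<longlonglongrightarrow> \<rho> * renyi_entropy (1 / (1 + \<rho>)) p
    \<and> (\<lambda>n. ln (opt_ranking_cost p \<rho> n (g n)) / real n)
        \<longlonglongrightarrow> \<rho> * renyi_entropy (1 / (1 + \<rho>)) p"
proof -
  define S where "S = (\<Sum>x\<in>UNIV. pmf p x powr (1 / (1 + \<rho>)))"
  have S: "S > 0" unfolding S_def by (rule sum_pmf_powr_pos)
  \<comment> \<open>The entropy prefactor is thus \<open>(1 + \<rho>) / \<rho>\<close>, and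
    multiplication by \<open>\<rho>\<close> leaves \<open>(1 + \<rho>) * ln S\<close>.\<close>
  have "1 - 1 / (1 + \<rho>) = \<rho> / (1 + \<rho>)" using assms(1) by (simp add: field_simps)
  then have limit: "\<rho> * renyi_entropy (1 / (1 + \<rho>)) p = ln (S powr (1 + \<rho>))"
    using assms(1) S by (simp add: renyi_entropy_def ln_powr flip: S_def)
  \<comment> \<open>\<open>enn2real\<close> sends infinity to \<open>0\<close>, so carrying the
    lower bound over to the reals requires finiteness.\<close>
  have fin: "opt_value A p \<rho> n < \<infinity>" for n
    using opt_value_le[OF assms(1), of A p n] by (simp add: order_le_less_trans)
  have lower: "(S powr (1 + \<rho>)) ^ n / (2 + real n * ln (real CARD('x))) powr \<rho>
      \<le> enn2real (opt_value A p \<rho> n)" for n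
    using enn2real_mono[OF opt_value_ge[OF assms(1-3), of p n]] fin[of n] by (simp add: S_def)
  have upper: "enn2real (opt_value A p \<rho> n) \<le> 6 * (2 * \<rho>) powr \<rho> * (S powr (1 + \<rho>)) ^ n" for n
    unfolding S_def by (intro enn2real_leI opt_value_le assms(1)) simp
  have "(\<lambda>n. ln (enn2real (opt_value A p \<rho> n)) / real n) \<longlonglongrightarrow> ln (S powr (1 + \<rho>))"
    using S assms(1) by (intro tendsto_ln_div_squeeze[OF _ _ _ lower upper]) simp_all
  moreover have "(\<lambda>n. ln (opt_ranking_cost p \<rho> n (g n)) / real n) \<longlonglongrightarrow> ln (S powr (1 + \<rho>))"
  proof (rule tendsto_ln_div_squeeze)
    show "(S powr (1 + \<rho>)) ^ n / (2 + real n * ln (real CARD('x))) powr \<rho>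
      \<le> opt_ranking_cost p \<rho> n (g n)" for n
      unfolding S_def using assms by (intro opt_ranking_cost_ge) auto
    show "opt_ranking_cost p \<rho> n (g n) \<le> 1 * (S powr (1 + \<rho>)) ^ n" for n
      unfolding S_def using assms by (intro opt_ranking_cost_le) auto
  qed (use S in simp_all)
  ultimately show ?thesis using fin by (simp add: limit)
qed

end
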